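(* For every integer $k\ge1$ and every complex $q$ with $|q|<1$, $$\sum_{\substack{n_k\ge\cdots\ge n_1\ge0\\ l_k\ge\cdots\ge l_1\ge0}}\frac{q^{n_1^2+\cdots+n_k^2+l_1^2+\cdots+l_k^2}}{(q;q)_{n_k-n_{k-1}}\cdots(q;q)_{n_2-n_1}\,(q;q)_{l_k-l_{k-1}}\cdots(q;q)_{l_2-l_1}}\cdot\frac{1}{(q;q)_{n_1+l_1}(q;q)_{n_1}(q;q)_{l_1}}$$ $$=\frac{1}{(q;q)_\infty}\prod_{\substack{m\ge1\\ m\not\equiv0,\pm(2k+1)\ (\mathrm{mod}\ 4k+3)}}\frac{1}{1-q^m}.$$
   Context: Notation: $(x;q)_n=\prod_{j=0}^{n-1}(1-xq^j)$ for integers $n\ge0$, and $(x;q)_\infty=\prod_{j\ge0}(1-xq^j)$. The sum is over integers $n_i,l_i$ ($1\le i\le k$); for $k=1$ the products of difference factors are empty (equal to 1). *)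

theory Defs
  imports "HOL-Analysis.Analysis" "HOL-Number_Theory.Cong"
begin

definition qpoch :: "complex \<Rightarrow> complex \<Rightarrow> nat \<Rightarrow> complex" where
  "qpoch x q n = (\<Prod>j<n. 1 - x * q ^ j)"

definition qpoch_inf :: "complex \<Rightarrow> complex \<Rightarrow> complex" where
  "qpoch_inf x q = (\<Prod>j. 1 - x * q ^ j)"

(* Extensional functions, so that each tuple (n_1,...,n_k) is represented exactly once. *)
definition nondecreasing_tuples :: "nat \<Rightarrow> (nat \<Rightarrow> nat) set" where
  "nondecreasing_tuples k = {n \<in> {1..k} \<rightarrow>\<^sub>E UNIV. \<forall>i\<in>{2..k}. n (i - 1) \<le> n i}"

(* prodinf is a total operator; the next two lemmas show that the infinite products
   in use converge for |q| < 1. *)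
lemma convergent_prod_qpoch_inf:
  fixes x q :: complex
  assumes "norm q < 1"
  shows "convergent_prod (\<lambda>j. 1 - x * q ^ j)"
proof -
  have "summable (\<lambda>j. norm x * norm q ^ j)"
    using assms by (intro summable_mult summable_geometric) auto
  hence "abs_convergent_prod (\<lambda>j. 1 - x * q ^ j)"
    by (simp add: abs_convergent_prod_conv_summable norm_mult norm_power)
  thus ?thesis by (rule abs_convergent_prod_imp_convergent_prod)
qed

lemma convergent_prod_restricted:
  fixes q :: complex
  assumes "norm q < 1"
  shows "convergent_prod (\<lambda>m. if P m then 1 / (1 - q ^ m) else 1)"
proof -
  have "summable (\<lambda>m. norm q ^ m)"
    using assms by (intro summable_geometric) auto
  hence "summable (\<lambda>m. norm ((if P m then 1 - q ^ m else 1) - 1))"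
    by (rule summable_comparison_test'[where N = 0]) (auto simp: norm_power)
  hence "abs_convergent_prod (\<lambda>m. if P m then 1 - q ^ m else 1)"
    by (simp add: abs_convergent_prod_conv_summable)
  hence "convergent_prod (\<lambda>m. if P m then 1 - q ^ m else 1)"
    by (rule abs_convergent_prod_imp_convergent_prod)
  hence "convergent_prod (\<lambda>m. inverse (if P m then 1 - q ^ m else 1))"
    by (rule convergent_prod_inverse)
  moreover have "(\<lambda>m. inverse (if P m then 1 - q ^ m else 1)) =
      (\<lambda>m. if P m then 1 / (1 - q ^ m) else 1)"
    by (auto simp: field_simps)
  ultimately show ?thesis by simp
qed

end

(* The kernel K(n,r) = 1/((q;q)_{n-r} (q;q)_{n+r}) of the Bailey transform (with a = 1) diagonalizes
   the summand: by the limiting q-Dixon sum,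
     1/((q;q)_{n+l} (q;q)_n (q;q)_l) = sum over integers r of (-1)^r q^{r(3r+1)/2} K(n,r) K(l,r).
   By q-Chu-Vandermonde, each summation over an entry of a tuple maps K(.,r) to q^{r^2} K(.,r), and
   the summation over the last, unbounded entry gives q^{r^2}/(q;q)_oo. So the sum over both tuples
   equals 1/(q;q)_oo^2 times the sum of (-1)^r q^{2kr^2 + r(3r+1)/2}, which is a product by the Jacobi
   triple product identity with base q^{4k+3}. *)

theory Submission
  imports Defs
begin

section \<open>Finite identities\<close>

text \<open>The obstacle is the factor 1/(q;q)_{n_1+l_1}, which couples the two tuples. For fixed r
  the kernel expansion splits into a function of \<open>n\<close> times a function of
  \<open>l\<close>, so each tuple can be summed alone. The price is an interchange of infinite sums.
  The kernel is only known to be bounded, uniformly in both arguments, so absolute summability over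
  triples (r, n, l) rests on the squares in the exponent for the tuples and on the decay of the
  Dixon coefficients for r. The kernel is even in r, so every bilateral sum is folded onto r >= 0,
  with the coefficients of r and -r added together. The Dixon coefficients are those of a triple
  product with base q^3. The 2k tuple entries contribute q^{2kr^2}, which raises the base by the
  factor q^{4k}; hence 4k+3. The q-Dixon, triple product and q-Chu-Vandermonde sums are first proved
  in finite form by one method: a first-order recurrence in the upper parameter whose defect has
  closed-form partial sums, so that each induction step is a polynomial identity in a few
  powers.\<close>

abbreviation (input) qfac :: "complex \<Rightarrow> nat \<Rightarrow> complex" where
  "qfac q n \<equiv> qpoch q q n"

lemma one_minus_power_nonzero:
  fixes q :: complex
  assumes "norm q < 1" and "n > 0"
  shows "1 - q ^ n \<noteq> 0"
proof
  assume "1 - q ^ n = 0"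
  hence "norm q ^ n = 1"
    by (metis eq_iff_diff_eq_0 norm_one norm_power)
  thus False
    using assms power_less_one_iff[of "norm q" n] by simp
qed

lemma qpoch_Suc: "qpoch x q (Suc n) = qpoch x q n * (1 - x * q ^ n)"
  by (simp add: qpoch_def)

lemma qpoch_0 [simp]: "qpoch x q 0 = 1"
  by (simp add: qpoch_def)

lemma qfac_Suc: "qfac q (Suc n) = qfac q n * (1 - q ^ Suc n)"
  by (simp add: qpoch_Suc)

lemma qfac_nonzero:
  assumes "norm q < 1"
  shows "qfac q n \<noteq> 0"
proof (induction n)
  case (Suc n)
  thus ?case
    using one_minus_power_nonzero[OF assms, of "Suc n"] unfolding qfac_Suc by simp
qed simp

section \<open>The Bailey kernel and its contiguous relations\<close>

text \<open>The value 0 for \<open>r > n\<close> is the convention 1/(q;q)_{-m} = 0 for m > 0;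
  truncated subtraction alone would give (q;q)_0 = 1 there. Natural \<open>r\<close> suffices
  because the kernel is invariant under r -> -r.\<close>

definition bailey_kernel :: "complex \<Rightarrow> nat \<Rightarrow> nat \<Rightarrow> complex" where
  "bailey_kernel q n r = (if r \<le> n then 1 / (qfac q (n - r) * qfac q (n + r)) else 0)"

text \<open>Cleared of denominators so that it includes the boundary \<open>r = n\<close>, where
  both sides vanish.\<close>

lemma bailey_kernel_Suc_right:
  assumes "norm q < 1" and "r \<le> n"
  shows "(1 - q ^ (n + r + 1)) * bailey_kernel q n (Suc r) = (1 - q ^ (n - r)) * bailey_kernel q n r"
proof (cases "r = n")
  case False
  with assms obtain d where n: "n = Suc (r + d)"
    using less_imp_Suc_add[of r n] by auto
  have [simp]: "qfac q m \<noteq> 0" for m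
    by (rule qfac_nonzero[OF assms(1)])
  have nz: "1 - q ^ (Suc d) \<noteq> 0" "1 - q ^ Suc (Suc (r + d) + r) \<noteq> 0"
    by (intro one_minus_power_nonzero assms; simp)+
  have "bailey_kernel q n (Suc r) = 1 / (qfac q d * (qfac q (Suc (r + d) + r) * (1 - q ^ Suc (Suc (r + d) + r))))"
    by (simp add: bailey_kernel_def n qfac_Suc [symmetric] del: power_Suc)
  moreover have "bailey_kernel q n r = 1 / (qfac q d * (1 - q ^ Suc d) * qfac q (Suc (r + d) + r))"
    by (simp add: bailey_kernel_def n Suc_diff_le qfac_Suc [symmetric] del: power_Suc)
  moreover have "n + r + 1 = Suc (Suc (r + d) + r)" "n - r = Suc d"
    by (simp_all add: n)
  ultimately show ?thesis
    using nz by (simp add: add_ac del: power_Suc)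
qed (simp add: bailey_kernel_def)

text \<open>At \<open>r = Suc n\<close> the kernel on the left is 0 and so is the first factor on
  the right. Including this case allows termwise comparison of sums for \<open>n\<close> and
  \<open>Suc n\<close> over a common range of \<open>r\<close>.\<close>

lemma bailey_kernel_Suc_left:
  assumes "norm q < 1" and "r \<le> Suc n"
  shows "bailey_kernel q n r =
    (1 - q ^ (Suc n - r)) * (1 - q ^ (Suc n + r)) * bailey_kernel q (Suc n) r"
proof (cases "r = Suc n")
  case False
  with assms obtain d where n: "n = r + d"
    using le_Suc_ex[of r n] by auto
  have [simp]: "qfac q m \<noteq> 0" for m
    by (rule qfac_nonzero[OF assms(1)])
  have nz: "1 - q ^ (Suc d) \<noteq> 0" "1 - q ^ Suc (r + d + r) \<noteq> 0"
    by (intro one_minus_power_nonzero assms; simp)+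
  have "bailey_kernel q (Suc n) r =
      1 / ((qfac q d * (1 - q ^ Suc d)) * (qfac q (r + d + r) * (1 - q ^ Suc (r + d + r))))"
    by (simp add: bailey_kernel_def n Suc_diff_le qfac_Suc [symmetric] del: power_Suc)
  moreover have "bailey_kernel q n r = 1 / (qfac q d * qfac q (r + d + r))"
    by (simp add: bailey_kernel_def n)
  moreover have "Suc n + r = Suc (r + d + r)" "Suc n - r = Suc d"
    by (simp_all add: n)
  ultimately show ?thesis
    using nz by (simp add: add_ac del: power_Suc)
qed (simp add: bailey_kernel_def)

text \<open>With \<open>Q = x * y\<close>, this is the sum of the terms \<open>(-1)^n * x^n * Q^(n(n-1)/2)\<close> for \<open>n = r\<close> and
  \<open>n = -r\<close>.\<close>

definition jacobi_coeff :: "complex \<Rightarrow> complex \<Rightarrow> nat \<Rightarrow> complex" where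
  "jacobi_coeff x y r = (if r = 0 then 1 else (-1) ^ r * (x * y) ^ (r choose 2) * (x ^ r + y ^ r))"

lemma choose_2_simps: "0 choose 2 = (0::nat)" "Suc n choose 2 = (n choose 2) + n"
  by (simp_all add: numeral_2_eq_2)

section \<open>The q-Dixon sum\<close>

text \<open>The bracket is the defect of the recurrence that multiplies the sum for \<open>A\<close>
  by (1 - q^A)(1 - q^(A+b)) and subtracts the sum for A - 1, after
  \<open>bailey_kernel_Suc_left\<close>. The right side vanishes once \<open>M\<close> reaches
  \<open>A\<close> or \<open>b\<close>, which yields the recurrence.\<close>

lemma dixon_partial_sum:
  assumes q: "norm q < 1" and "M \<le> A" and "M \<le> b"
  shows "(\<Sum>r\<le>M. ((1 - q ^ A) * (1 - q ^ (A + b)) - (1 - q ^ (A - r)) * (1 - q ^ (A + r))) *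
            jacobi_coeff q (q\<^sup>2) r * bailey_kernel q A r * bailey_kernel q b r) =
         (-1) ^ M * q ^ (3 * (Suc M choose 2) + A) * (1 - q ^ (A - M)) * (1 - q ^ (b - M)) *
            bailey_kernel q A M * bailey_kernel q b M"
  using assms(2,3)
proof (induction M)
  case 0
  show ?case
    by (simp add: jacobi_coeff_def choose_2_simps power_add algebra_simps)
next
  case (Suc M)
  \<comment> \<open>The gaps \<open>d\<close> and \<open>f\<close> remove truncated subtraction. All
    kernel values are then referred to the index \<open>Suc M\<close>, and only the powers
    \<open>X\<close>, \<open>D\<close>, \<open>F\<close> remain.\<close>
  define d f where "d = A - Suc M" and "f = b - Suc M"
  have A: "A = Suc M + d" and b: "b = Suc M + f"
    using Suc.prems by (simp_all add: d_def f_def)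
  define X D F where "X = q ^ Suc M" and "D = q ^ d" and "F = q ^ f"
  define u v where "u = bailey_kernel q A (Suc M)" and "v = bailey_kernel q b (Suc M)"
  define E where "E = q ^ (3 * (Suc M choose 2))"
  have pA: "q ^ A = X * D" "q ^ (A + b) = X^2 * D * F" "q ^ (A - Suc M) = D" "q ^ (A + Suc M) = X^2 * D"
    "q ^ (A + M + 1) = X^2 * D" "q ^ (b - Suc M) = F" "q ^ (b + M + 1) = X^2 * F"
    by (simp_all add: X_def D_def F_def A b power_add power2_eq_square)
  have E': "q ^ (3 * (Suc (Suc M) choose 2) + A) = E * X ^ 4 * D"
  proof -
    have "3 * (Suc (Suc M) choose 2) + A = 3 * (Suc M choose 2) + (Suc M + Suc M + Suc M + A)"
      using choose_2_simps(2)[of "Suc M"] by simp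
    thus ?thesis
      by (simp only: power_add pA(1) X_def [symmetric] E_def [symmetric] power4_eq_xxxx mult_ac)
  qed
  have E0: "q ^ (3 * (Suc M choose 2) + A) = E * X * D"
    by (simp add: E_def power_add pA(1))
  have dix: "jacobi_coeff q (q\<^sup>2) (Suc M) = - ((-1) ^ M * E * X * (1 + X))"
  proof -
    have "q * q\<^sup>2 = q ^ 3" "(q\<^sup>2) ^ Suc M = X * X"
      by (simp_all add: X_def power2_eq_square power3_eq_cube power_mult_distrib)
    hence "jacobi_coeff q (q\<^sup>2) (Suc M) = (-1) ^ Suc M * E * (X + X * X)"
      unfolding E_def power_mult by (simp add: jacobi_coeff_def X_def)
    thus ?thesis
      by (simp add: algebra_simps)
  qed
  have u: "(1 - q ^ (A - M)) * bailey_kernel q A M = (1 - X^2 * D) * u"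
    using bailey_kernel_Suc_right[OF q, of M A] Suc.prems unfolding u_def pA by simp
  have v: "(1 - q ^ (b - M)) * bailey_kernel q b M = (1 - X^2 * F) * v"
    using bailey_kernel_Suc_right[OF q, of M b] Suc.prems unfolding v_def pA by simp
  have "(\<Sum>r\<le>M. ((1 - q ^ A) * (1 - q ^ (A + b)) - (1 - q ^ (A - r)) * (1 - q ^ (A + r))) *
            jacobi_coeff q (q\<^sup>2) r * bailey_kernel q A r * bailey_kernel q b r) =
      (-1) ^ M * q ^ (3 * (Suc M choose 2) + A) * ((1 - q ^ (A - M)) * bailey_kernel q A M) *
      ((1 - q ^ (b - M)) * bailey_kernel q b M)"
    using Suc by (simp add: mult_ac)
  also have "\<dots> = (-1) ^ M * (E * X * D) * ((1 - X^2 * D) * u) * ((1 - X^2 * F) * v)"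
    by (simp only: u v E0)
  finally have IH: "(\<Sum>r\<le>M. ((1 - q ^ A) * (1 - q ^ (A + b)) - (1 - q ^ (A - r)) * (1 - q ^ (A + r))) *
            jacobi_coeff q (q\<^sup>2) r * bailey_kernel q A r * bailey_kernel q b r) = \<dots>" .
  \<comment> \<open>The sign (-1)^M and the power \<open>E\<close> enter linearly, so they can be
    treated as free variables; what remains is a polynomial identity.\<close>
  have alg: "s * (E * X * D) * ((1 - X\<^sup>2 * D) * u) * ((1 - X\<^sup>2 * F) * v) +
    ((1 - X * D) * (1 - X\<^sup>2 * D * F) - (1 - D) * (1 - X\<^sup>2 * D)) * - (s * E * X * (1 + X)) * u * v =
    (- s) * (E * X ^ 4 * D) * (1 - D) * (1 - F) * u * v" for s
    by algebra
  show ?case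
    unfolding sum.atMost_Suc IH unfolding dix E' pA u_def [symmetric] v_def [symmetric]
    using alg[of "(-1) ^ M"] by simp
qed

text \<open>This is the limit \<open>c \<rightarrow> \<infinity>\<close> of the \<open>q\<close>-Dixon sum, with the terms of index \<open>r\<close> and \<open>-r\<close> of the
  bilateral series combined; only after this symmetrization does it have the closed-form
  telescoping partial sums of \<open>dixon_partial_sum\<close>.\<close>

lemma q_dixon_limit:
  assumes q: "norm q < 1"
  shows "(\<Sum>r\<le>b. jacobi_coeff q (q\<^sup>2) r * bailey_kernel q a r * bailey_kernel q b r) =
         1 / (qfac q (a + b) * qfac q a * qfac q b)"
proof (induction a)
  case 0
  have "(\<Sum>r\<le>b. jacobi_coeff q (q\<^sup>2) r * bailey_kernel q 0 r * bailey_kernel q b r) =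
        (\<Sum>r\<in>{0}. jacobi_coeff q (q\<^sup>2) r * bailey_kernel q 0 r * bailey_kernel q b r)"
    by (intro sum.mono_neutral_right) (auto simp: bailey_kernel_def)
  thus ?case
    by (simp add: jacobi_coeff_def bailey_kernel_def)
next
  case (Suc a)
  define t where "t A r = jacobi_coeff q (q\<^sup>2) r * bailey_kernel q A r * bailey_kernel q b r" for A r
  \<comment> \<open>At this cutoff no nonzero term is lost, and one of the factors 1 - q^(A-M), 1 -
    q^(b-M) of the closed form, with \<open>A = Suc a\<close>, is zero.\<close>
  define M where "M = min (Suc a) b"
  have restrict: "(\<Sum>r\<le>b. t A r) = (\<Sum>r\<le>M. t A r)" if "A \<le> Suc a" for A
    using that by (intro sum.mono_neutral_right) (auto simp: t_def bailey_kernel_def M_def)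
  have nz: "1 - q ^ Suc a \<noteq> 0" "1 - q ^ (Suc a + b) \<noteq> 0"
    by (intro one_minus_power_nonzero q; simp)+
  have "(1 - q ^ Suc a) * (1 - q ^ (Suc a + b)) * (\<Sum>r\<le>b. t (Suc a) r) - (\<Sum>r\<le>b. t a r) =
    (\<Sum>r\<le>M. (1 - q ^ Suc a) * (1 - q ^ (Suc a + b)) * t (Suc a) r - t a r)"
    by (simp only: restrict sum_subtractf sum_distrib_left le_refl le_SucI)
  also have "\<dots> = (\<Sum>r\<le>M. ((1 - q ^ Suc a) * (1 - q ^ (Suc a + b)) - (1 - q ^ (Suc a - r)) * (1 - q ^ (Suc a + r))) *
            jacobi_coeff q (q\<^sup>2) r * bailey_kernel q (Suc a) r * bailey_kernel q b r)"
  proof (rule sum.cong)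
    fix r assume "r \<in> {..M}"
    hence "r \<le> Suc a"
      by (simp add: M_def)
    show "(1 - q ^ Suc a) * (1 - q ^ (Suc a + b)) * t (Suc a) r - t a r =
        ((1 - q ^ Suc a) * (1 - q ^ (Suc a + b)) - (1 - q ^ (Suc a - r)) * (1 - q ^ (Suc a + r))) *
            jacobi_coeff q (q\<^sup>2) r * bailey_kernel q (Suc a) r * bailey_kernel q b r"
      unfolding t_def bailey_kernel_Suc_left[OF q \<open>r \<le> Suc a\<close>] by (simp only: algebra_simps)
  qed simp
  also have "\<dots> = 0"
    by (subst dixon_partial_sum[OF q]) (auto simp: M_def min_def)
  finally have "(1 - q ^ Suc a) * (1 - q ^ (Suc a + b)) * (\<Sum>r\<le>b. t (Suc a) r) =
      1 / (qfac q (a + b) * qfac q a * qfac q b)"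
    using Suc.IH by (simp add: t_def)
  hence "(\<Sum>r\<le>b. t (Suc a) r) =
      1 / (qfac q (a + b) * qfac q a * qfac q b) / ((1 - q ^ Suc a) * (1 - q ^ (Suc a + b)))"
    using nz by (metis mult_eq_0_iff nonzero_mult_div_cancel_left)
  also have "\<dots> = 1 / (qfac q (Suc a + b) * qfac q (Suc a) * qfac q b)"
    by (simp add: qfac_Suc mult_ac del: power_Suc)
  finally show ?case
    by (simp add: t_def)
qed

section \<open>The finite triple product\<close>

text \<open>Telescoping certificate for the recurrence that takes \<open>N\<close> to
  \<open>Suc N\<close> in \<open>finite_jacobi_triple_product\<close>: the left side compares the
  two sums term by term, with the factors expected from the product side.\<close>

lemma jacobi_partial_sum:
  assumes Q: "norm Q < 1" and xy: "x * y = Q" and "M \<le> N"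
  shows "(\<Sum>r\<le>M. jacobi_coeff x y r * ((1 - Q ^ (2 * N + 1)) * (1 - Q ^ (2 * N + 2)) * bailey_kernel Q (Suc N) r -
            (1 - x * Q ^ N) * (1 - y * Q ^ N) * bailey_kernel Q N r)) =
         (-1) ^ M * Q ^ (N + (M choose 2)) * (bailey_kernel Q N M * (x ^ Suc M + y ^ Suc M) +
            Q ^ Suc M * bailey_kernel Q N (Suc M) * (x ^ M + y ^ M))"
  using assms(3)
proof (induction M)
  case 0
  define u where "u = bailey_kernel Q (Suc N) 0"
  define X where "X = Q ^ N"
  have 1: "bailey_kernel Q N 0 = (1 - Q * X)^2 * u"
    using bailey_kernel_Suc_left[OF Q, of 0 N] by (simp add: u_def power2_eq_square X_def)
  have "(1 - Q * X) * bailey_kernel Q N (Suc 0) = (1 - X) * bailey_kernel Q N 0"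
    using bailey_kernel_Suc_right[OF Q, of 0 N] by (simp add: X_def)
  moreover have "1 - Q * X \<noteq> 0"
    using one_minus_power_nonzero[OF Q, of "Suc N"] by (simp add: X_def)
  ultimately have 2: "bailey_kernel Q N (Suc 0) = (1 - X) * (1 - Q * X) * u"
    unfolding 1 by (simp add: power2_eq_square)
  have 3: "Q ^ Suc (2 * N) = Q * X^2" "Q ^ Suc (Suc (2 * N)) = Q^2 * X^2"
    by (simp_all add: X_def power_mult power2_eq_square power_mult_distrib flip: power_mult_distrib)
  show ?case
    by (simp add: jacobi_coeff_def choose_2_simps u_def [symmetric] X_def [symmetric] 1 2 3 del: power_Suc)
       (unfold xy [symmetric], algebra)
next
  case (Suc M)
  define d where "d = N - Suc M"
  have N: "N = Suc M + d"
    using Suc.prems by (simp add: d_def)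
  define X D P E u where "X = Q ^ Suc M" and "D = Q ^ d" and "P = Q ^ M"
    and "E = Q ^ (M choose 2)" and "u = bailey_kernel Q (Suc N) (Suc M)"
  have pows: "Q ^ N = X * D" "Q ^ (2 * N + 1) = Q * X^2 * D^2" "Q ^ (2 * N + 2) = Q^2 * X^2 * D^2"
    "Q ^ Suc (Suc M) = Q * X"
    by (simp_all add: X_def D_def N power_add power_mult power2_eq_square algebra_simps power_mult_distrib)
  have nz: "1 - Q * D \<noteq> 0" "1 - Q * X^2 * D \<noteq> 0"
    using one_minus_power_nonzero[OF Q, of "Suc d"] one_minus_power_nonzero[OF Q, of "N + M + 2"]
    by (simp_all add: X_def D_def N power_add power2_eq_square algebra_simps)
  have g1: "bailey_kernel Q N (Suc M) = (1 - Q * D) * (1 - Q * X^2 * D) * u"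
    using bailey_kernel_Suc_left[OF Q, of "Suc M" N]
    by (simp add: u_def X_def D_def N power_add power2_eq_square algebra_simps)
  have "(1 - X^2 * D) * bailey_kernel Q N (Suc M) = (1 - Q * D) * bailey_kernel Q N M"
    using bailey_kernel_Suc_right[OF Q, of M N]
    by (simp add: X_def D_def N power_add power2_eq_square algebra_simps)
  hence g0: "bailey_kernel Q N M = (1 - X^2 * D) * (1 - Q * X^2 * D) * u"
    using nz(1) unfolding g1 by (simp add: mult_ac)
  have "(1 - Q * X^2 * D) * bailey_kernel Q N (Suc (Suc M)) = (1 - D) * bailey_kernel Q N (Suc M)"
    using bailey_kernel_Suc_right[OF Q, of "Suc M" N]
    by (simp add: X_def D_def N power_add power2_eq_square algebra_simps)
  hence g2: "bailey_kernel Q N (Suc (Suc M)) = (1 - D) * (1 - Q * D) * u"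
    using nz(2) unfolding g1 by (simp add: mult_ac)
  have coeff: "jacobi_coeff x y (Suc M) = - ((-1) ^ M * E * P * (x ^ Suc M + y ^ Suc M))"
    by (simp add: jacobi_coeff_def E_def P_def xy choose_2_simps power_add)
  have E': "Q ^ (N + (Suc M choose 2)) = X * D * E * P" "Q ^ (N + (M choose 2)) = X * D * E"
    by (simp_all add: E_def P_def pows power_add choose_2_simps)
  have X: "X = Q * P"
    by (simp add: X_def P_def)
  \<comment> \<open>The powers x^M and y^M become free variables \<open>xs\<close> and
    \<open>ys\<close>. The identity needs the relations \<open>X = Q * P\<close> and
    \<open>x * y = Q\<close>, which are therefore substituted first.\<close>
  have alg: "s * (X * D * E) * ((1 - X\<^sup>2 * D) * (1 - Q * X\<^sup>2 * D) * u * (x * xs + y * ys) +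
       X * ((1 - Q * D) * (1 - Q * X\<^sup>2 * D) * u) * (xs + ys)) +
     - (s * E * P * (x * xs + y * ys)) *
       ((1 - Q * X\<^sup>2 * D\<^sup>2) * (1 - Q\<^sup>2 * X\<^sup>2 * D\<^sup>2) * u -
        (1 - x * (X * D)) * (1 - y * (X * D)) * ((1 - Q * D) * (1 - Q * X\<^sup>2 * D) * u)) =
     - s * (X * D * E * P) * ((1 - Q * D) * (1 - Q * X\<^sup>2 * D) * u * (x * (x * xs) + y * (y * ys)) +
        Q * X * ((1 - D) * (1 - Q * D) * u) * (x * xs + y * ys))" for s xs ys
    unfolding X xy [symmetric] by algebra
  show ?case
    unfolding sum.atMost_Suc Suc.IH[OF Suc_leD[OF Suc.prems]] unfolding coeff E' pows g0 g1 g2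
      u_def [symmetric] X_def [symmetric]
    using alg[of "(-1) ^ M" "x ^ M" "y ^ M"] by (simp only: power_Suc mult_minus1 mult_minus_left mult_1)
qed


text \<open>This is the q-binomial theorem centred at its middle term: the kernel is the Gaussian
  binomial of 2N over N + r, divided by (Q;Q)_{2N}. Written this way, the triple product is its
  limit, with the bounds already needed for the kernel.\<close>

lemma finite_jacobi_triple_product:
  assumes Q: "norm Q < 1" and xy: "x * y = Q"
  shows "(\<Sum>r\<le>N. jacobi_coeff x y r * bailey_kernel Q N r) =
         qpoch x Q N * qpoch y Q N / qfac Q (2 * N)"
proof (induction N)
  case 0
  show ?case
    by (simp add: jacobi_coeff_def bailey_kernel_def)
next
  case (Suc N)
  define S where "S n = (\<Sum>r\<le>n. jacobi_coeff x y r * bailey_kernel Q n r)" for n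
  define A B where "A = (1 - Q ^ (2 * N + 1)) * (1 - Q ^ (2 * N + 2))"
    and "B = (1 - x * Q ^ N) * (1 - y * Q ^ N)"
  have A: "A \<noteq> 0"
    unfolding A_def using one_minus_power_nonzero[OF Q] by (metis add_gr_0 less_numeral_extra(1) no_zero_divisors zero_less_numeral)
  have "(\<Sum>r\<le>N. jacobi_coeff x y r * (A * bailey_kernel Q (Suc N) r - B * bailey_kernel Q N r)) =
        (-1) ^ N * Q ^ (N + (N choose 2)) * bailey_kernel Q N N * (x ^ Suc N + y ^ Suc N)"
    unfolding A_def B_def mult.assoc
    using jacobi_partial_sum[OF Q xy, of N N] by (simp add: bailey_kernel_def mult_ac)
  \<comment> \<open>Unlike in the Dixon sum, the certificate does not vanish at the end of the
    range. Its value is minus the term \<open>r = Suc N\<close>, which only the larger sum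
    contains.\<close>
  also have "\<dots> = - (jacobi_coeff x y (Suc N) * (A * bailey_kernel Q (Suc N) (Suc N)))"
  proof -
    have "bailey_kernel Q N N = A * bailey_kernel Q (Suc N) (Suc N)"
      using A one_minus_power_nonzero[OF Q, of "Suc (2 * N)"] one_minus_power_nonzero[OF Q, of "Suc (Suc (2 * N))"]
      by (simp add: bailey_kernel_def A_def mult_2 [symmetric] qfac_Suc del: power_Suc)
    thus ?thesis
      by (simp add: jacobi_coeff_def xy choose_2_simps power_add)
  qed
  finally have "A * S (Suc N) - B * S N = 0"
    by (simp add: S_def sum_subtractf sum_distrib_left algebra_simps)
  hence "S (Suc N) = B * S N / A"
    using A by (simp add: field_simps)
  also have "\<dots> = qpoch x Q (Suc N) * qpoch y Q (Suc N) / qfac Q (2 * Suc N)"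
    using Suc.IH by (simp add: S_def A_def B_def qfac_Suc qpoch_Suc[of x] qpoch_Suc[of y] mult_ac del: power_Suc)
  finally show ?case
    by (simp add: S_def)
qed

section \<open>q-Chu-Vandermonde and the Bailey step\<close>

text \<open>Multiplying a term by 1 - q^(N-j) lowers \<open>N\<close> by one, so the left side is
  again the defect of a recurrence in \<open>N\<close>. The factor 1 - q^(N-M) makes it vanish at
  \<open>M = N\<close>.\<close>

lemma q_vandermonde_partial_sum:
  assumes q: "norm q < 1" and "M \<le> N"
  shows "(\<Sum>j\<le>M. ((1 - q ^ N) * (1 - q ^ (N + c)) - (1 - q ^ (N - j))) *
            (q ^ (j * (j + c)) / (qfac q (N - j) * qfac q j * qfac q (j + c)))) =
         - (q ^ (N + M + c + M * (M + c)) * (1 - q ^ (N - M)) / (qfac q (N - M) * qfac q M * qfac q (M + c)))"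
  using assms(2)
proof (induction M)
  case 0
  show ?case
    by (simp add: power_add algebra_simps diff_divide_distrib)
next
  case (Suc M)
  define d where "d = N - Suc M"
  have N: "N = Suc M + d"
    using Suc.prems by (simp add: d_def)
  define X D C where "X = q ^ Suc M" and "D = q ^ d" and "C = q ^ c"
  define u where "u = 1 / (qfac q d * qfac q (Suc M) * qfac q (Suc M + c))"
  define E where "E = q ^ (M * (M + c))"
  define P where "P = q ^ M"
  have [simp]: "qfac q m \<noteq> 0" for m
    by (rule qfac_nonzero[OF q])
  have 1: "(1 - q ^ (N - M)) / (qfac q (N - M) * qfac q M * qfac q (M + c)) = (1 - X) * (1 - X * C) * u"
  proof -
    have nz: "1 - q ^ Suc d \<noteq> 0" "1 - q ^ Suc M \<noteq> 0" "1 - q ^ Suc (M + c) \<noteq> 0"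
      by (intro one_minus_power_nonzero q; simp)+
    have XC: "X * C = q ^ Suc (M + c)"
      by (simp add: X_def C_def power_add)
    show ?thesis
      unfolding XC using nz by (simp add: N Suc_diff_le u_def X_def qfac_Suc del: power_Suc)
  qed
  have pows: "q ^ N = X * D" "q ^ (N + c) = X * D * C" "q ^ (N - Suc M) = D"
    "q ^ (N + M + c + M * (M + c)) = X * D * P * C * E"
    "q ^ (N + Suc M + c + Suc M * (Suc M + c)) = X * D * X * C * (E * P * X * C)"
    "q ^ (Suc M * (Suc M + c)) = E * P * X * C"
    by (simp_all add: X_def D_def C_def E_def P_def N power_add algebra_simps)
  have frac: "e / (qfac q (N - Suc M) * qfac q (Suc M) * qfac q (Suc M + c)) = e * u" for e
    by (simp add: u_def N)
  have "(\<Sum>j\<le>M. ((1 - q ^ N) * (1 - q ^ (N + c)) - (1 - q ^ (N - j))) *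
            (q ^ (j * (j + c)) / (qfac q (N - j) * qfac q j * qfac q (j + c)))) =
      - (q ^ (N + M + c + M * (M + c)) * ((1 - q ^ (N - M)) / (qfac q (N - M) * qfac q M * qfac q (M + c))))"
    using Suc by simp
  also have "\<dots> = - (X * D * P * C * E * ((1 - X) * (1 - X * C) * u))"
    unfolding pows 1 ..
  finally have IH: "(\<Sum>j\<le>M. ((1 - q ^ N) * (1 - q ^ (N + c)) - (1 - q ^ (N - j))) *
            (q ^ (j * (j + c)) / (qfac q (N - j) * qfac q j * qfac q (j + c)))) = \<dots>" .
  show ?case
    unfolding sum.atMost_Suc IH unfolding pows frac by algebra
qed

lemma q_vandermonde:
  assumes q: "norm q < 1"
  shows "(\<Sum>j\<le>N. q ^ (j * (j + c)) / (qfac q (N - j) * qfac q j * qfac q (j + c))) =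
         1 / (qfac q N * qfac q (N + c))"
proof (induction N)
  case (Suc N)
  define t where "t n j = q ^ (j * (j + c)) / (qfac q (n - j) * qfac q j * qfac q (j + c))" for n j
  have nz: "1 - q ^ Suc N \<noteq> 0" "1 - q ^ (Suc N + c) \<noteq> 0"
    by (intro one_minus_power_nonzero q; simp)+
  have step: "t N j = (1 - q ^ (Suc N - j)) * t (Suc N) j" if "j \<le> N" for j
    using that one_minus_power_nonzero[OF q, of "Suc N - j"]
    by (simp add: t_def Suc_diff_le qfac_Suc del: power_Suc)
  \<comment> \<open>The range can be extended because the factor is 0 at
    \<open>j = Suc N\<close>.\<close>
  have "(\<Sum>j\<le>N. t N j) = (\<Sum>j\<le>Suc N. (1 - q ^ (Suc N - j)) * t (Suc N) j)"
    by (simp add: step)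
  hence "(1 - q ^ Suc N) * (1 - q ^ (Suc N + c)) * (\<Sum>j\<le>Suc N. t (Suc N) j) - (\<Sum>j\<le>N. t N j) =
        (\<Sum>j\<le>Suc N. ((1 - q ^ Suc N) * (1 - q ^ (Suc N + c)) - (1 - q ^ (Suc N - j))) * t (Suc N) j)"
    by (simp only: left_diff_distrib [of _ _ "t _ _"] sum_subtractf sum_distrib_left)
  also have "\<dots> = 0"
    unfolding t_def by (subst q_vandermonde_partial_sum[OF q]) auto
  finally have "(1 - q ^ Suc N) * (1 - q ^ (Suc N + c)) * (\<Sum>j\<le>Suc N. t (Suc N) j) =
      1 / (qfac q N * qfac q (N + c))"
    using Suc.IH by (simp add: t_def)
  hence "(\<Sum>j\<le>Suc N. t (Suc N) j) =
      1 / (qfac q N * qfac q (N + c)) / ((1 - q ^ Suc N) * (1 - q ^ (Suc N + c)))"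
    using nz by (metis mult_eq_0_iff nonzero_mult_div_cancel_left)
  also have "\<dots> = 1 / (qfac q (Suc N) * qfac q (Suc N + c))"
    by (simp add: qfac_Suc mult_ac del: power_Suc)
  finally show ?case
    by (simp add: t_def)
qed simp

text \<open>The shift m = j + s gives m^2 = s^2 + j(j + 2s), so this is \<open>q_vandermonde\<close>
  with \<open>c = 2 * s\<close> and upper limit n - s.\<close>

lemma bailey_step:
  assumes q: "norm q < 1"
  shows "(\<Sum>m\<le>n. q ^ m\<^sup>2 / qfac q (n - m) * bailey_kernel q m s) = q ^ s\<^sup>2 * bailey_kernel q n s"
proof (cases "s \<le> n")
  case True
  have "(\<Sum>m\<le>n. q ^ m\<^sup>2 / qfac q (n - m) * bailey_kernel q m s) =
        (\<Sum>m\<in>{s..n}. q ^ m\<^sup>2 / qfac q (n - m) * bailey_kernel q m s)"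
    by (intro sum.mono_neutral_right) (auto simp: bailey_kernel_def)
  also have "\<dots> = (\<Sum>j\<le>n - s. q ^ (j + s)\<^sup>2 / qfac q (n - (j + s)) * bailey_kernel q (j + s) s)"
    by (rule sum.reindex_bij_witness[of _ "\<lambda>j. j + s" "\<lambda>m. m - s"]) (use True in auto)
  also have "\<dots> = q ^ s\<^sup>2 * (\<Sum>j\<le>n - s. q ^ (j * (j + 2 * s)) /
      (qfac q (n - s - j) * qfac q j * qfac q (j + 2 * s)))"
    unfolding sum_distrib_left
  proof (intro sum.cong refl)
    fix j
    have "(j + s)\<^sup>2 = s\<^sup>2 + j * (j + 2 * s)"
      by (simp add: power2_eq_square algebra_simps)
    thus "q ^ (j + s)\<^sup>2 / qfac q (n - (j + s)) * bailey_kernel q (j + s) s =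
      q ^ s\<^sup>2 * (q ^ (j * (j + 2 * s)) / (qfac q (n - s - j) * qfac q j * qfac q (j + 2 * s)))"
      by (simp add: bailey_kernel_def power_add mult_2 add_ac)
  qed
  also have "\<dots> = q ^ s\<^sup>2 * bailey_kernel q n s"
    using True by (subst q_vandermonde[OF q]) (simp add: bailey_kernel_def add_ac)
  finally show ?thesis .
qed (simp add: bailey_kernel_def)

section \<open>The Jacobi triple product\<close>

lemma qpoch_tendsto:
  assumes "norm q < 1"
  shows "(\<lambda>n. qpoch x q n) \<longlonglongrightarrow> qpoch_inf x q"
proof -
  have "(\<lambda>n. qpoch x q (Suc n)) \<longlonglongrightarrow> qpoch_inf x q"
    using convergent_prod_LIMSEQ[OF convergent_prod_qpoch_inf[OF assms, of x]]
    by (simp add: qpoch_def qpoch_inf_def lessThan_Suc_atMost)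
  thus ?thesis
    by (simp only: filterlim_sequentially_Suc)
qed

lemma qpoch_inf_nonzero:
  assumes "norm q < 1"
  shows "qpoch_inf q q \<noteq> 0"
  unfolding qpoch_inf_def
proof (rule prodinf_nonzero)
  show "1 - q * q ^ j \<noteq> 0" for j
    using one_minus_power_nonzero[OF assms, of "Suc j"] by simp
qed (rule convergent_prod_qpoch_inf[OF assms])

lemma inverse_qfac_bounded:
  assumes "norm q < 1"
  obtains C where "C > 0" and "\<And>n. norm (1 / qfac q n) \<le> C"
proof -
  have "(\<lambda>n. 1 / qfac q n) \<longlonglongrightarrow> 1 / qpoch_inf q q"
    by (intro tendsto_intros qpoch_tendsto assms qpoch_inf_nonzero)
  hence "Bseq (\<lambda>n. 1 / qfac q n)"
    by (intro convergent_imp_Bseq convergentI)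
  thus ?thesis
    using that by (auto elim: BseqE)
qed

lemma bailey_kernel_bounded:
  assumes "norm q < 1"
  obtains C where "C > 0" and "\<And>n r. norm (bailey_kernel q n r) \<le> C"
proof -
  obtain C where C: "C > 0" "\<And>n. norm (1 / qfac q n) \<le> C"
    using inverse_qfac_bounded[OF assms] by blast
  have "norm (bailey_kernel q n r) \<le> C * C" for n r
  proof (cases "r \<le> n")
    case True
    have "norm (bailey_kernel q n r) = norm (1 / qfac q (n - r)) * norm (1 / qfac q (n + r))"
      using True by (simp add: bailey_kernel_def norm_divide norm_mult)
    also have "\<dots> \<le> C * C"
      by (intro mult_mono C) (use C(1) in auto)
    finally show ?thesis .
  qed (use C(1) in \<open>simp add: bailey_kernel_def\<close>)
  thus ?thesis
    using that[of "C * C"] C(1) by simp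
qed

text \<open>The limit does not depend on \<open>r\<close>, so in limits of sums over
  \<open>r\<close> it comes out as a common factor.\<close>

lemma bailey_kernel_tendsto:
  assumes "norm q < 1"
  shows "(\<lambda>n. bailey_kernel q n r) \<longlonglongrightarrow> 1 / (qpoch_inf q q)\<^sup>2"
proof -
  have "(\<lambda>n. 1 / (qfac q n * qfac q (n + 2 * r))) \<longlonglongrightarrow> 1 / (qpoch_inf q q * qpoch_inf q q)"
    by (intro tendsto_intros qpoch_tendsto assms LIMSEQ_ignore_initial_segment)
       (use qpoch_inf_nonzero[OF assms] in simp)
  moreover have "1 / (qfac q n * qfac q (n + 2 * r)) = bailey_kernel q (n + r) r" for n
    by (simp add: bailey_kernel_def mult_2 add_ac)
  ultimately show ?thesis
    by (simp add: power2_eq_square LIMSEQ_offset)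
qed

text \<open>Tannery's theorem for a growing range of summation: the terms are padded by 0 beyond
  \<open>n\<close>, which changes each of them for only finitely many \<open>n\<close>.\<close>

lemma finite_sums_tendsto_suminf:
  fixes f :: "nat \<Rightarrow> nat \<Rightarrow> complex"
  assumes "\<And>r. (\<lambda>n. f n r) \<longlonglongrightarrow> g r"
    and "\<And>n r. r \<le> n \<Longrightarrow> norm (f n r) \<le> M r" and "summable M"
  shows "summable (\<lambda>r. norm (g r))" and "(\<lambda>n. \<Sum>r\<le>n. f n r) \<longlonglongrightarrow> (\<Sum>r. g r)"
proof -
  define h where "h r n = (if r \<le> n then f n r else 0)" for r n
  have "\<forall>\<^sub>F n in sequentially. f n r = h r n" for r
    using eventually_ge_at_top[of r] by eventually_elim (simp add: h_def)
  hence lim: "h r \<longlonglongrightarrow> g r" for r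
    using assms(1)[of r] by (rule Lim_transform_eventually[rotated])
  have M: "M r \<ge> 0" for r
    using assms(2)[of r r] norm_ge_zero[of "f r r"] by linarith
  hence "norm (h r n) \<le> M r" for r n
    using assms(2)[of r n] by (simp add: h_def)
  hence bound: "\<forall>\<^sub>F (r, n) in at_top \<times>\<^sub>F sequentially. norm (h r n) \<le> M r"
    by (intro always_eventually) auto
  note tannery = tannerys_theorem[OF lim bound assms(3) sequentially_bot]
  show "summable (\<lambda>r. norm (g r))"
    using tannery by blast
  have "(\<Sum>r. h r n) = (\<Sum>r\<le>n. f n r)" for n
    by (subst suminf_finite[of "{..n}"]) (auto simp: h_def)
  thus "(\<lambda>n. \<Sum>r\<le>n. f n r) \<longlonglongrightarrow> (\<Sum>r. g r)"
    using tannery by simp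
qed

text \<open>The quadratic power is bounded by 1; the geometric majorant that remains is
  summable.\<close>

lemma jacobi_coeff_norm_le:
  assumes "norm x < 1" and "norm y < 1"
  shows "norm (jacobi_coeff x y r) \<le> norm x ^ r + norm y ^ r"
proof -
  have "norm (x * y) ^ (r choose 2) \<le> 1"
    using assms by (intro power_le_one) (auto simp: norm_mult intro: mult_le_one)
  moreover have "norm (x ^ r + y ^ r) \<le> norm x ^ r + norm y ^ r"
    by (metis norm_power norm_triangle_ineq)
  ultimately have "norm (x * y) ^ (r choose 2) * norm (x ^ r + y ^ r) \<le> 1 * (norm x ^ r + norm y ^ r)"
    by (intro mult_mono) auto
  thus ?thesis
    by (simp add: jacobi_coeff_def norm_mult norm_power)
qed

lemma summable_norm_jacobi_coeff:
  assumes "norm x < 1" and "norm y < 1"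
  shows "summable (\<lambda>r. norm (jacobi_coeff x y r))"
proof (rule summable_comparison_test')
  show "summable (\<lambda>r. norm x ^ r + norm y ^ r)"
    using assms by (intro summable_add summable_geometric) auto
  show "norm (norm (jacobi_coeff x y r)) \<le> norm x ^ r + norm y ^ r" for r
    using jacobi_coeff_norm_le[OF assms] by simp
qed

text \<open>Let N tend to infinity in the finite form. The kernel contributes 1/(Q;Q)_oo^2 on the
  left and (Q;Q)_{2N} contributes 1/(Q;Q)_oo on the right, which leaves one factor (Q;Q)_oo.\<close>

lemma jacobi_triple_product:
  assumes x: "norm x < 1" and y: "norm y < 1"
  shows "(\<Sum>r. jacobi_coeff x y r) =
         qpoch_inf x (x * y) * qpoch_inf y (x * y) * qpoch_inf (x * y) (x * y)"
proof -
  define Q where "Q = x * y"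
  have "norm Q \<le> norm x * 1"
    unfolding Q_def norm_mult using y by (intro mult_left_mono) auto
  with x have Q: "norm Q < 1"
    by simp
  obtain C where C: "C > 0" "\<And>n r. norm (bailey_kernel Q n r) \<le> C"
    using bailey_kernel_bounded[OF Q] by blast
  note nz = qpoch_inf_nonzero[OF Q]
  have "(\<lambda>n. \<Sum>r\<le>n. jacobi_coeff x y r * bailey_kernel Q n r) \<longlonglongrightarrow>
        (\<Sum>r. jacobi_coeff x y r * (1 / (qpoch_inf Q Q)\<^sup>2))"
  proof (rule finite_sums_tendsto_suminf)
    show "summable (\<lambda>r. norm (jacobi_coeff x y r) * C)"
      using summable_norm_jacobi_coeff[OF x y] by (rule summable_mult2)
    show "(\<lambda>n. jacobi_coeff x y r * bailey_kernel Q n r) \<longlonglongrightarrow> jacobi_coeff x y r * (1 / (qpoch_inf Q Q)\<^sup>2)" for r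
      by (intro tendsto_intros bailey_kernel_tendsto Q)
    show "norm (jacobi_coeff x y r * bailey_kernel Q n r) \<le> norm (jacobi_coeff x y r) * C" for n r
      unfolding norm_mult by (intro mult_left_mono C norm_ge_zero)
  qed
  moreover have "(\<lambda>n. \<Sum>r\<le>n. jacobi_coeff x y r * bailey_kernel Q n r) \<longlonglongrightarrow>
      qpoch_inf x Q * qpoch_inf y Q / qpoch_inf Q Q"
  proof -
    have "filterlim (\<lambda>n::nat. 2 * n) sequentially sequentially"
      by (intro filterlim_subseq) (auto simp: strict_mono_def)
    hence "(\<lambda>n. qfac Q (2 * n)) \<longlonglongrightarrow> qpoch_inf Q Q"
      by (rule filterlim_compose[OF qpoch_tendsto[OF Q]])
    hence "(\<lambda>n. qpoch x Q n * qpoch y Q n / qfac Q (2 * n)) \<longlonglongrightarrow>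
        qpoch_inf x Q * qpoch_inf y Q / qpoch_inf Q Q"
      by (intro tendsto_intros qpoch_tendsto Q nz)
    thus ?thesis
      by (simp add: finite_jacobi_triple_product[OF Q Q_def[symmetric]])
  qed
  ultimately have "(\<Sum>r. jacobi_coeff x y r * (1 / (qpoch_inf Q Q)\<^sup>2)) =
      qpoch_inf x Q * qpoch_inf y Q / qpoch_inf Q Q"
    by (rule LIMSEQ_unique)
  moreover have "(\<Sum>r. jacobi_coeff x y r * (1 / (qpoch_inf Q Q)\<^sup>2)) =
      (\<Sum>r. jacobi_coeff x y r) * (1 / (qpoch_inf Q Q)\<^sup>2)"
    by (rule suminf_mult2 [symmetric]) (rule summable_norm_cancel[OF summable_norm_jacobi_coeff[OF x y]])
  ultimately have "(\<Sum>r. jacobi_coeff x y r) / (qpoch_inf Q Q)\<^sup>2 =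
      qpoch_inf x Q * qpoch_inf y Q / qpoch_inf Q Q"
    by simp
  thus ?thesis
    using nz unfolding Q_def [symmetric] by (simp add: power2_eq_square divide_eq_eq)
qed

section \<open>Summation over tuples\<close>

lemma summable_power_square:
  assumes "0 \<le> p" and "p < (1::real)"
  shows "summable (\<lambda>n. p ^ n\<^sup>2)"
proof (rule summable_comparison_test')
  show "summable (\<lambda>n. p ^ n)"
    using assms by (intro summable_geometric) auto
  show "norm (p ^ n\<^sup>2) \<le> p ^ n" for n
    using assms power_decreasing[of n "n\<^sup>2" p] by (cases n) (auto simp: power2_eq_square)
qed

text \<open>The limit n -> infinity of \<open>bailey_step\<close>, multiplied by (q;q)_oo.\<close>

lemma infinite_bailey_step:
  assumes q: "norm q < 1"
  shows "((\<lambda>m. q ^ m\<^sup>2 * bailey_kernel q m s) has_sum (q ^ s\<^sup>2 / qpoch_inf q q)) UNIV"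
proof -
  obtain C where C: "C > 0" "\<And>n. norm (1 / qfac q n) \<le> C"
    using inverse_qfac_bounded[OF q] by blast
  obtain D where D: "D > 0" "\<And>n r. norm (bailey_kernel q n r) \<le> D"
    using bailey_kernel_bounded[OF q] by blast
  note nz = qpoch_inf_nonzero[OF q]
  define f where "f n m = q ^ m\<^sup>2 / qfac q (n - m) * bailey_kernel q m s" for n m
  define g where "g m = q ^ m\<^sup>2 / qpoch_inf q q * bailey_kernel q m s" for m
  have lim: "(\<lambda>n. f n m) \<longlonglongrightarrow> g m" for m
  proof -
    have "(\<lambda>n. qfac q (n - m)) \<longlonglongrightarrow> qpoch_inf q q"
      by (rule LIMSEQ_offset[of _ m]) (simp add: qpoch_tendsto[OF q])
    thus ?thesis
      unfolding f_def g_def by (intro tendsto_intros nz)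
  qed
  have bound: "norm (f n m) \<le> norm q ^ m\<^sup>2 * (C * D)" for n m
  proof -
    have "norm (f n m) = norm q ^ m\<^sup>2 * (norm (1 / qfac q (n - m)) * norm (bailey_kernel q m s))"
      by (simp add: f_def norm_mult norm_divide norm_power)
    also have "\<dots> \<le> norm q ^ m\<^sup>2 * (C * D)"
      by (intro mult_left_mono mult_mono C D) (use C(1) in auto)
    finally show ?thesis .
  qed
  have sm: "summable (\<lambda>m. norm q ^ m\<^sup>2 * (C * D))"
    using q by (intro summable_mult2 summable_power_square) auto
  note conv = finite_sums_tendsto_suminf[OF lim bound sm]
  have "(\<lambda>n. \<Sum>m\<le>n. f n m) \<longlonglongrightarrow> q ^ s\<^sup>2 * (1 / (qpoch_inf q q)\<^sup>2)"
    unfolding f_def bailey_step[OF q] by (intro tendsto_intros bailey_kernel_tendsto q)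
  hence "(\<Sum>m. g m) = q ^ s\<^sup>2 * (1 / (qpoch_inf q q)\<^sup>2)"
    using conv(2) LIMSEQ_unique by blast
  hence "(g has_sum (q ^ s\<^sup>2 * (1 / (qpoch_inf q q)\<^sup>2))) UNIV"
    using conv(1) summable_norm_cancel[OF conv(1)] by (intro norm_summable_imp_has_sum) (auto simp: sums_iff)
  from has_sum_cmult_right[OF this, of "qpoch_inf q q"] show ?thesis
    using nz by (simp add: g_def power2_eq_square)
qed

section \<open>Tuples built up by their last entry\<close>

text \<open>The guard matters at \<open>k = 0\<close>: there \<open>n 0\<close> is an unspecified
  number and must not constrain the single empty tuple.\<close>

definition truncated_tuples :: "nat \<Rightarrow> nat \<Rightarrow> (nat \<Rightarrow> nat) set" where
  "truncated_tuples k m = {n \<in> nondecreasing_tuples k. k > 0 \<longrightarrow> n k \<le> m}"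

lemma nondecreasing_tuples_0: "nondecreasing_tuples 0 = {\<lambda>_. undefined}"
  by (auto simp: nondecreasing_tuples_def)

text \<open>The set \<open>B\<close> of admissible last entries serves two uses:
  \<open>{..N}\<close> for truncated tuples and \<open>UNIV\<close> for all tuples.\<close>

lemma bij_betw_nondecreasing_tuples_Suc:
  "bij_betw (\<lambda>(m, n). n(Suc k := m)) (SIGMA m:B. truncated_tuples k m)
     {n \<in> nondecreasing_tuples (Suc k). n (Suc k) \<in> B}"
\<comment> \<open>Removing the last entry must restore \<open>undefined\<close> at
  \<open>Suc k\<close> to keep the tuple extensional.\<close>
proof (rule bij_betwI[where g = "\<lambda>n. (n (Suc k), n(Suc k := undefined))"])
  show "(\<lambda>(m, n). n(Suc k := m)) \<in> (SIGMA m:B. truncated_tuples k m) \<rightarrow>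
      {n \<in> nondecreasing_tuples (Suc k). n (Suc k) \<in> B}"
  proof safe
    fix m n assume m: "m \<in> B" and "n \<in> truncated_tuples k m"
    hence n: "n \<in> {1..k} \<rightarrow>\<^sub>E UNIV" "\<And>i. i \<in> {2..k} \<Longrightarrow> n (i - 1) \<le> n i" "k > 0 \<Longrightarrow> n k \<le> m"
      by (auto simp: truncated_tuples_def nondecreasing_tuples_def)
    have "(n(Suc k := m)) (i - 1) \<le> (n(Suc k := m)) i" if "i \<in> {2..Suc k}" for i
      using that n(2)[of i] n(3) by (cases "i = Suc k") auto
    moreover have "n(Suc k := m) \<in> {1..Suc k} \<rightarrow>\<^sub>E UNIV"
      using n(1) by (auto simp: PiE_def extensional_def)
    ultimately show "n(Suc k := m) \<in> nondecreasing_tuples (Suc k)"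
      by (auto simp: nondecreasing_tuples_def)
  qed auto
  show "(\<lambda>n. (n (Suc k), n(Suc k := undefined))) \<in> {n \<in> nondecreasing_tuples (Suc k). n (Suc k) \<in> B} \<rightarrow>
      (SIGMA m:B. truncated_tuples k m)"
  proof safe
    fix n assume "n \<in> nondecreasing_tuples (Suc k)"
    hence n: "n \<in> {1..Suc k} \<rightarrow>\<^sub>E UNIV" "\<And>i. i \<in> {2..Suc k} \<Longrightarrow> n (i - 1) \<le> n i"
      by (auto simp: nondecreasing_tuples_def)
    have "(n(Suc k := undefined)) (i - 1) \<le> (n(Suc k := undefined)) i" if "i \<in> {2..k}" for i
      using that n(2)[of i] by auto
    moreover have "n(Suc k := undefined) \<in> {1..k} \<rightarrow>\<^sub>E UNIV"
      using n(1) by (auto simp: PiE_def extensional_def)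
    moreover have "k > 0 \<Longrightarrow> n k \<le> n (Suc k)"
      using n(2)[of "Suc k"] by simp
    ultimately show "n(Suc k := undefined) \<in> truncated_tuples k (n (Suc k))"
      by (auto simp: truncated_tuples_def nondecreasing_tuples_def)
  qed
next
  fix p assume "p \<in> (SIGMA m:B. truncated_tuples k m)"
  moreover have "n (Suc k) = undefined" if "n \<in> truncated_tuples k m" for n m
    using that by (auto simp: truncated_tuples_def nondecreasing_tuples_def PiE_def extensional_def)
  ultimately show "(\<lambda>n. (n (Suc k), n(Suc k := undefined))) ((\<lambda>(m, n). n(Suc k := m)) p) = p"
    by (force simp: fun_eq_iff)
qed simp

lemma finite_truncated_tuples: "finite (truncated_tuples k m)"
proof (induction k arbitrary: m)
  case (Suc k)
  have "bij_betw (\<lambda>(m, n). n(Suc k := m)) (SIGMA m:{..m}. truncated_tuples k m) (truncated_tuples (Suc k) m)"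
    using bij_betw_nondecreasing_tuples_Suc[of k "{..m}"] by (simp add: truncated_tuples_def)
  moreover have "finite (SIGMA m:{..m}. truncated_tuples k m)"
    using Suc by (intro finite_SigmaI) auto
  ultimately show ?case
    using bij_betw_finite by blast
qed (simp add: truncated_tuples_def nondecreasing_tuples_0)

definition tuple_weight :: "complex \<Rightarrow> nat \<Rightarrow> (nat \<Rightarrow> nat) \<Rightarrow> complex" where
  "tuple_weight q k n = q ^ (\<Sum>i=1..k. (n i)\<^sup>2) / (\<Prod>i=2..k. qfac q (n i - n (i - 1)))"

text \<open>For \<open>k = 0\<close> there is no entry \<open>n 1\<close>; the bound \<open>N\<close> takes its place, which makes
  \<open>truncated_tuple_sum\<close> an induction starting at \<open>k = 0\<close>.\<close>

definition truncated_term :: "complex \<Rightarrow> nat \<Rightarrow> nat \<Rightarrow> nat \<Rightarrow> (nat \<Rightarrow> nat) \<Rightarrow> complex" where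
  "truncated_term q s k N n = (if k = 0 then bailey_kernel q N s
     else tuple_weight q k n / qfac q (N - n k) * bailey_kernel q (n 1) s)"

lemma tuple_weight_Suc:
  "tuple_weight q (Suc k) (n(Suc k := m)) * bailey_kernel q ((n(Suc k := m)) 1) s =
   q ^ m\<^sup>2 * truncated_term q s k m n"
proof (cases "k = 0")
  case False
  have "(\<Sum>i=1..k. ((n(Suc k := m)) i)\<^sup>2) = (\<Sum>i=1..k. (n i)\<^sup>2)"
    by (intro sum.cong) auto
  moreover have "(\<Prod>i=2..k. qfac q ((n(Suc k := m)) i - (n(Suc k := m)) (i - 1))) =
      (\<Prod>i=2..k. qfac q (n i - n (i - 1)))"
    by (intro prod.cong) auto
  ultimately show ?thesis
    using False by (simp add: tuple_weight_def truncated_term_def power_add)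
qed (simp add: tuple_weight_def truncated_term_def)

text \<open>The last entry m becomes the bound for the remaining entries, so the sum is iterated.
  Each stage reproduces the kernel with a new bound by \<open>bailey_step\<close>, at the cost of
  one factor q^(s^2).\<close>

lemma truncated_tuple_sum:
  assumes q: "norm q < 1"
  shows "(\<Sum>n\<in>truncated_tuples k N. truncated_term q s k N n) = q ^ (k * s\<^sup>2) * bailey_kernel q N s"
proof (induction k arbitrary: N)
  case 0
  show ?case
    by (simp add: truncated_tuples_def nondecreasing_tuples_0 truncated_term_def)
next
  case (Suc k)
  have "bij_betw (\<lambda>(m, n). n(Suc k := m)) (SIGMA m:{..N}. truncated_tuples k m) (truncated_tuples (Suc k) N)"
    using bij_betw_nondecreasing_tuples_Suc[of k "{..N}"] by (simp add: truncated_tuples_def)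
  hence "(\<Sum>n\<in>truncated_tuples (Suc k) N. truncated_term q s (Suc k) N n) =
      (\<Sum>(m, n)\<in>(SIGMA m:{..N}. truncated_tuples k m). truncated_term q s (Suc k) N (n(Suc k := m)))"
    by (subst sum.reindex_bij_betw[symmetric]) (auto simp: case_prod_unfold)
  also have "\<dots> = (\<Sum>m\<le>N. \<Sum>n\<in>truncated_tuples k m. truncated_term q s (Suc k) N (n(Suc k := m)))"
    by (subst sum.Sigma) (auto simp: finite_truncated_tuples)
  also have "\<dots> = (\<Sum>m\<le>N. q ^ m\<^sup>2 / qfac q (N - m) * (\<Sum>n\<in>truncated_tuples k m. truncated_term q s k m n))"
    unfolding sum_distrib_left
  proof (intro sum.cong refl)
    fix m n
    show "truncated_term q s (Suc k) N (n(Suc k := m)) = q ^ m\<^sup>2 / qfac q (N - m) * truncated_term q s k m n"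
      using tuple_weight_Suc[of q k n m s] by (simp add: truncated_term_def [of q s "Suc k"] field_simps)
  qed
  also have "\<dots> = q ^ (k * s\<^sup>2) * (\<Sum>m\<le>N. q ^ m\<^sup>2 / qfac q (N - m) * bailey_kernel q m s)"
    by (simp add: Suc sum_distrib_left mult_ac)
  also have "\<dots> = q ^ (Suc k * s\<^sup>2) * bailey_kernel q N s"
    by (subst bailey_step[OF q]) (simp add: power_add)
  finally show ?case .
qed

section \<open>Absolute convergence and the sum over one tuple\<close>

lemma summable_on_power_sum_squares:
  fixes p :: real and k :: nat
  assumes p: "0 \<le> p" "p < 1"
  shows "(\<lambda>n. p ^ (\<Sum>i=1..k. (n i)\<^sup>2)) summable_on ({1..k} \<rightarrow>\<^sub>E UNIV)"
proof -
  define c where "c = infsum (\<lambda>n. p ^ n\<^sup>2) (UNIV :: nat set)"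
  have sm: "(\<lambda>n. norm (p ^ n\<^sup>2)) summable_on (UNIV :: nat set)"
    using summable_power_square[OF p] p
    by (subst summable_on_UNIV_nonneg_real_iff) auto
  have "infsum (\<lambda>n. \<Prod>i\<in>{1..k}. p ^ (n i)\<^sup>2) ({1..k} \<rightarrow>\<^sub>E UNIV) = c ^ k"
    using infsum_prod_PiE_abs[of "{1..k}" "\<lambda>_ n. p ^ n\<^sup>2" "\<lambda>_. UNIV"] sm by (simp add: c_def)
  \<comment> \<open>Positivity gives summability: \<open>infsum\<close> is 0 for families that are
    not summable, whereas here its value is \<open>c ^ k\<close>.\<close>
  moreover have "c > 0"
  proof -
    have "(\<Sum>n\<in>{0}. p ^ n\<^sup>2) \<le> c"
      unfolding c_def using sm p by (intro finite_sum_le_infsum) (auto dest: abs_summable_summable)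
    thus ?thesis by simp
  qed
  ultimately have "(\<lambda>n. \<Prod>i\<in>{1..k}. p ^ (n i)\<^sup>2) summable_on ({1..k} \<rightarrow>\<^sub>E UNIV)"
    using infsum_not_exists by fastforce
  thus ?thesis
    by (simp add: power_sum)
qed

text \<open>The reciprocals of (q;q)_m are uniformly bounded, so the denominators cost a constant,
  and the order condition merely selects a subset of all tuples.\<close>

lemma tuple_weight_abs_summable:
  assumes q: "norm q < 1"
  shows "(\<lambda>n. norm (tuple_weight q k n)) summable_on nondecreasing_tuples k"
proof -
  obtain C where C: "C > 0" "\<And>n. norm (1 / qfac q n) \<le> C"
    using inverse_qfac_bounded[OF q] by blast
  have sm: "(\<lambda>n. norm q ^ (\<Sum>i=1..k. (n i)\<^sup>2)) summable_on nondecreasing_tuples k"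
    by (rule summable_on_subset_banach[OF summable_on_power_sum_squares])
       (use q in \<open>auto simp: nondecreasing_tuples_def\<close>)
  show ?thesis
  proof (rule Infinite_Sum.abs_summable_on_comparison_test')
    show "(\<lambda>n. norm q ^ (\<Sum>i=1..k. (n i)\<^sup>2) * C ^ card {2..k}) summable_on nondecreasing_tuples k"
      using sm by (rule summable_on_cmult_left)
    fix n
    have "norm (tuple_weight q k n) = norm q ^ (\<Sum>i=1..k. (n i)\<^sup>2) * (\<Prod>i=2..k. norm (1 / qfac q (n i - n (i - 1))))"
      by (simp add: tuple_weight_def norm_divide norm_power prod_norm [symmetric] prod_dividef)
    also have "\<dots> \<le> norm q ^ (\<Sum>i=1..k. (n i)\<^sup>2) * (\<Prod>i=2..k. C)"
      by (intro mult_left_mono prod_mono) (use C in auto)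
    finally show "norm (tuple_weight q k n) \<le> norm q ^ (\<Sum>i=1..k. (n i)\<^sup>2) * C ^ card {2..k}"
      by simp
  qed
qed

lemma tuple_sum:
  assumes q: "norm q < 1" and "k > 0"
  shows "((\<lambda>n. tuple_weight q k n * bailey_kernel q (n 1) s) has_sum (q ^ (k * s\<^sup>2) / qpoch_inf q q))
           (nondecreasing_tuples k)"
proof -
  obtain j where k: "k = Suc j"
    using \<open>k > 0\<close> gr0_implies_Suc by blast
  define f where "f n = tuple_weight q k n * bailey_kernel q (n 1) s" for n
  have bij: "bij_betw (\<lambda>(m, n). n(k := m)) (SIGMA m:UNIV. truncated_tuples j m) (nondecreasing_tuples k)"
    using bij_betw_nondecreasing_tuples_Suc[of j UNIV] by (simp add: k)
  obtain D where D: "D > 0" "\<And>n r. norm (bailey_kernel q n r) \<le> D"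
    using bailey_kernel_bounded[OF q] by blast
  have "(\<lambda>n. norm (f n)) summable_on nondecreasing_tuples k"
  proof (rule Infinite_Sum.abs_summable_on_comparison_test')
    show "(\<lambda>n. norm (tuple_weight q k n) * D) summable_on nondecreasing_tuples k"
      by (intro summable_on_cmult_left tuple_weight_abs_summable q)
  qed (simp add: f_def norm_mult D mult_left_mono)
  hence "f summable_on nondecreasing_tuples k"
    by (rule abs_summable_summable)
  hence sm: "(\<lambda>(m, n). f (n(k := m))) summable_on (SIGMA m:UNIV. truncated_tuples j m)"
    using summable_on_reindex_bij_betw[OF bij, of f] by (simp add: case_prod_unfold)
  have "((\<lambda>(m, n). f (n(k := m))) has_sum (q ^ (k * s\<^sup>2) / qpoch_inf q q)) (SIGMA m:UNIV. truncated_tuples j m)"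
  proof (rule has_sum_SigmaI[OF _ _ sm])
    fix m :: nat
    have "(\<Sum>n\<in>truncated_tuples j m. f (n(k := m))) =
        q ^ (j * s\<^sup>2) * (q ^ m\<^sup>2 * bailey_kernel q m s)"
      unfolding f_def k tuple_weight_Suc
      by (simp only: sum_distrib_left [symmetric] truncated_tuple_sum[OF q] mult.left_commute)
    thus "((\<lambda>n. case (m, n) of (m, n) \<Rightarrow> f (n(k := m))) has_sum q ^ (j * s\<^sup>2) * (q ^ m\<^sup>2 * bailey_kernel q m s))
        (truncated_tuples j m)"
      by (intro has_sum_finiteI) (auto simp: finite_truncated_tuples)
  next
    have "((\<lambda>m. q ^ (j * s\<^sup>2) * (q ^ m\<^sup>2 * bailey_kernel q m s)) has_sum (q ^ (j * s\<^sup>2) * (q ^ s\<^sup>2 / qpoch_inf q q))) UNIV"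
      by (intro has_sum_cmult_right infinite_bailey_step q)
    thus "((\<lambda>m. q ^ (j * s\<^sup>2) * (q ^ m\<^sup>2 * bailey_kernel q m s)) has_sum (q ^ (k * s\<^sup>2) / qpoch_inf q q)) UNIV"
      by (simp add: k power_add mult_ac)
  qed
  hence "(f has_sum (q ^ (k * s\<^sup>2) / qpoch_inf q q)) (nondecreasing_tuples k)"
    using has_sum_reindex_bij_betw[OF bij, of f] by (simp add: case_prod_unfold)
  thus ?thesis
    unfolding f_def .
qed

section \<open>The product side\<close>

text \<open>Since r^2 = 2 (r choose 2) + r, the factor q^(2kr^2) multiplies the base q^3 by q^(4k)
  and each of the two arguments by q^(2k).\<close>

lemma jacobi_coeff_shift:
  "jacobi_coeff q (q\<^sup>2) r * q ^ (2 * k * r\<^sup>2) = jacobi_coeff (q ^ (2 * k + 1)) (q ^ (2 * k + 2)) r"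
proof (cases "r = 0")
  case False
  have r: "r\<^sup>2 = 2 * (r choose 2) + r"
    by (induction r) (simp_all add: choose_2_simps power2_eq_square)
  have "q * q\<^sup>2 = q ^ 3" "q ^ (2 * k + 1) * q ^ (2 * k + 2) = q ^ (4 * k + 3)"
    unfolding power_add [symmetric] by (simp add: power2_eq_square power3_eq_cube, rule arg_cong) simp
  hence pows: "(q * q\<^sup>2) ^ (r choose 2) = q ^ (3 * (r choose 2))"
    "(q ^ (2 * k + 1) * q ^ (2 * k + 2)) ^ (r choose 2) = q ^ ((4 * k + 3) * (r choose 2))"
    "(q\<^sup>2) ^ r = q ^ (2 * r)" "(q ^ (2 * k + 1)) ^ r = q ^ ((2 * k + 1) * r)"
    "(q ^ (2 * k + 2)) ^ r = q ^ ((2 * k + 2) * r)"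
    by (simp_all only: power_mult)
  have "q ^ (3 * (r choose 2)) * ((q ^ r + q ^ (2 * r)) * q ^ (2 * k * r\<^sup>2)) =
      q ^ ((4 * k + 3) * (r choose 2)) * (q ^ ((2 * k + 1) * r) + q ^ ((2 * k + 2) * r))"
    unfolding r by (simp add: algebra_simps flip: power_add)
  thus ?thesis
    unfolding jacobi_coeff_def pows by (simp only: False if_False mult.assoc)
qed (simp add: jacobi_coeff_def)

text \<open>A block holds the exponents with residues 1, ..., 4k+3, since the factors of (q;q)_oo
  start at q^1; thus offset \<open>i\<close> has residue i + 1. The residue -(2k+1) is represented
  by 2k+2.\<close>

lemma cong_block_iff:
  fixes i k N :: nat
  assumes "i < 4 * k + 3"
  defines "m \<equiv> (4 * k + 3) * N + i + 1"
  shows "[int m = 0] (mod (4 * int k + 3)) \<longleftrightarrow> i = 4 * k + 2"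
    and "[int m = 2 * int k + 1] (mod (4 * int k + 3)) \<longleftrightarrow> i = 2 * k"
    and "[int m = - (2 * int k + 1)] (mod (4 * int k + 3)) \<longleftrightarrow> i = 2 * k + 1"
proof -
  define K where "K = 4 * int k + 3"
  have m: "int m mod K = (if i = 4 * k + 2 then 0 else int i + 1)"
  proof -
    have "int m = int i + 1 + K * int N"
      by (simp add: m_def K_def)
    hence "int m mod K = (int i + 1) mod K"
      by simp
    moreover have "int i + 1 = K" if "i = 4 * k + 2"
      using that by (simp add: K_def)
    moreover have "int i + 1 < K" if "i \<noteq> 4 * k + 2"
      using that assms(1) by (simp add: K_def)
    ultimately show ?thesis
      by auto
  qed
  have c: "(2 * int k + 1) mod K = 2 * int k + 1"
    by (rule mod_pos_pos_trivial) (simp_all add: K_def)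
  have "(- (2 * int k + 1)) mod K = (- (2 * int k + 1) + K) mod K"
    by (rule mod_add_self2 [symmetric])
  also have "\<dots> = 2 * int k + 2"
    by (subst mod_pos_pos_trivial) (simp_all add: K_def)
  finally have c': "(- (2 * int k + 1)) mod K = 2 * int k + 2" .
  show "[int m = 0] (mod (4 * int k + 3)) \<longleftrightarrow> i = 4 * k + 2"
    "[int m = 2 * int k + 1] (mod (4 * int k + 3)) \<longleftrightarrow> i = 2 * k"
    "[int m = - (2 * int k + 1)] (mod (4 * int k + 3)) \<longleftrightarrow> i = 2 * k + 1"
    unfolding cong_def K_def [symmetric] m c c' by auto
qed

text \<open>Every admissible factor cancels, and the exponents left over form three progressions
  with difference 4k+3. Comparing partial products after whole blocks keeps the cancellation finite;
  no infinite product is rearranged.\<close>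

lemma qpoch_inf_times_restricted_product:
  fixes q :: complex and k :: nat
  assumes q: "norm q < 1"
  defines "x \<equiv> q ^ (2 * k + 1)" and "y \<equiv> q ^ (2 * k + 2)" and "Q \<equiv> q ^ (4 * k + 3)"
  shows "qpoch_inf q q * (\<Prod>m. if m \<ge> 1 \<and>
                     \<not> [int m = 0] (mod (4 * int k + 3)) \<and>
                     \<not> [int m = 2 * int k + 1] (mod (4 * int k + 3)) \<and>
                     \<not> [int m = - (2 * int k + 1)] (mod (4 * int k + 3))
                  then 1 / (1 - q ^ m) else 1) =
         qpoch_inf x Q * qpoch_inf y Q * qpoch_inf Q Q"
proof -
  define P where "P m \<longleftrightarrow> m \<ge> 1 \<and>
                     \<not> [int m = 0] (mod (4 * int k + 3)) \<and>
                     \<not> [int m = 2 * int k + 1] (mod (4 * int k + 3)) \<and>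
                     \<not> [int m = - (2 * int k + 1)] (mod (4 * int k + 3))" for m :: nat
  define R where "R m = (if P m then 1 / (1 - q ^ m) else 1)" for m
  define K where "K = 4 * k + 3"
  have Q: "norm Q < 1"
    using q by (simp add: Q_def norm_power power_less_one_iff)
  have finite: "qfac q (K * N) * (\<Prod>m\<le>K * N. R m) = qpoch x Q N * qpoch y Q N * qpoch Q Q N" for N
  proof (induction N)
    case 0
    show ?case
      by (simp add: R_def P_def)
  next
    case (Suc N)
    have qfac_add: "qfac q (K * N + j) = qfac q (K * N) * (\<Prod>i<j. 1 - q ^ (K * N + i + 1))" for j
      by (induction j) (simp_all add: qfac_Suc mult_ac)
    have R_add: "(\<Prod>m\<le>K * N + j. R m) = (\<Prod>m\<le>K * N. R m) * (\<Prod>i<j. R (K * N + i + 1))" for j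
      by (induction j) (simp_all add: mult_ac)
    have P_iff: "P (K * N + i + 1) \<longleftrightarrow> i \<notin> {2 * k, 2 * k + 1, 4 * k + 2}" if "i < K" for i
      using cong_block_iff[of i k N] that unfolding P_def K_def by auto
    \<comment> \<open>Only three factors of a block survive; they are the next factors of the three
      products with base \<open>Q\<close>.\<close>
    have "(\<Prod>i<K. (1 - q ^ (K * N + i + 1)) * R (K * N + i + 1)) =
        (\<Prod>i\<in>{2 * k, 2 * k + 1, 4 * k + 2}. 1 - q ^ (K * N + i + 1))"
    proof (rule prod.mono_neutral_cong_right)
      show "\<forall>i\<in>{..<K} - {2 * k, 2 * k + 1, 4 * k + 2}. (1 - q ^ (K * N + i + 1)) * R (K * N + i + 1) = 1"
      proof
        fix i assume "i \<in> {..<K} - {2 * k, 2 * k + 1, 4 * k + 2}"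
        hence "P (K * N + i + 1)"
          using P_iff[of i] by simp
        thus "(1 - q ^ (K * N + i + 1)) * R (K * N + i + 1) = 1"
          using one_minus_power_nonzero[OF q, of "K * N + i + 1"] by (simp add: R_def)
      qed
    next
      fix i assume i: "i \<in> {2 * k, 2 * k + 1, 4 * k + 2}"
      hence "i < K"
        by (auto simp: K_def)
      hence "\<not> P (K * N + i + 1)"
        using P_iff[of i] i by blast
      thus "(1 - q ^ (K * N + i + 1)) * R (K * N + i + 1) = 1 - q ^ (K * N + i + 1)"
        by (simp add: R_def)
    qed (auto simp: K_def)
    also have "\<dots> = (1 - x * Q ^ N) * (1 - y * Q ^ N) * (1 - Q * Q ^ N)"
    proof -
      have "q ^ (K * N + 2 * k + 1) = x * Q ^ N" "q ^ (K * N + (2 * k + 1) + 1) = y * Q ^ N"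
        "q ^ (K * N + (4 * k + 2) + 1) = Q * Q ^ N"
        unfolding x_def y_def Q_def power_mult [symmetric] power_add [symmetric]
        by (rule arg_cong[of _ _ "power q"], simp add: K_def algebra_simps)+
      thus ?thesis
        by (simp add: mult_ac)
    qed
    finally have block: "(\<Prod>i<K. 1 - q ^ (K * N + i + 1)) * (\<Prod>i<K. R (K * N + i + 1)) = \<dots>"
      by (simp add: prod.distrib)
    have K_Suc: "K * Suc N = K * N + K"
      by simp
    have "qfac q (K * Suc N) * (\<Prod>m\<le>K * Suc N. R m) =
        (qfac q (K * N) * (\<Prod>m\<le>K * N. R m)) *
        ((\<Prod>i<K. 1 - q ^ (K * N + i + 1)) * (\<Prod>i<K. R (K * N + i + 1)))"
      unfolding K_Suc qfac_add R_add by (simp only: mult_ac)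
    also have "\<dots> = qpoch x Q (Suc N) * qpoch y Q (Suc N) * qpoch Q Q (Suc N)"
      unfolding Suc.IH block by (simp add: qpoch_Suc mult_ac)
    finally show ?case .
  qed
  have sub: "filterlim (\<lambda>N. K * N) sequentially sequentially"
    by (intro filterlim_subseq) (auto simp: strict_mono_def K_def)
  have "(\<lambda>N. qfac q (K * N) * (\<Prod>m\<le>K * N. R m)) \<longlonglongrightarrow> qpoch_inf q q * prodinf R"
  proof (intro tendsto_mult)
    show "(\<lambda>N. qfac q (K * N)) \<longlonglongrightarrow> qpoch_inf q q"
      by (rule filterlim_compose[OF qpoch_tendsto[OF q] sub])
    have "(\<lambda>n. \<Prod>m\<le>n. R m) \<longlonglongrightarrow> prodinf R"
      unfolding R_def by (intro convergent_prod_LIMSEQ convergent_prod_restricted q)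
    thus "(\<lambda>N. \<Prod>m\<le>K * N. R m) \<longlonglongrightarrow> prodinf R"
      by (rule filterlim_compose[OF _ sub])
  qed
  moreover have "(\<lambda>N. qfac q (K * N) * (\<Prod>m\<le>K * N. R m)) \<longlonglongrightarrow> qpoch_inf x Q * qpoch_inf y Q * qpoch_inf Q Q"
    unfolding finite by (intro tendsto_mult qpoch_tendsto Q)
  ultimately show ?thesis
    unfolding R_def P_def using LIMSEQ_unique by blast
qed

section \<open>Interchange of the summations\<close>

lemma summable_on_norm_times:
  fixes f :: "'a \<Rightarrow> complex" and g :: "'b \<Rightarrow> complex"
  assumes "(\<lambda>x. norm (f x)) summable_on A" and "(\<lambda>y. norm (g y)) summable_on B"
  shows "(\<lambda>(x, y). norm (f x * g y)) summable_on A \<times> B"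
proof (rule summable_on_SigmaI)
  show "((\<lambda>y. case (x, y) of (x, y) \<Rightarrow> norm (f x * g y)) has_sum (norm (f x) * infsum (\<lambda>y. norm (g y)) B)) B" for x
    using assms(2) by (simp add: norm_mult has_sum_cmult_right)
  show "(\<lambda>x. norm (f x) * infsum (\<lambda>y. norm (g y)) B) summable_on A"
    using assms(1) by (rule summable_on_cmult_left)
qed auto

lemma has_sum_times:
  fixes f :: "'a \<Rightarrow> complex" and g :: "'b \<Rightarrow> complex"
  assumes "(\<lambda>x. norm (f x)) summable_on A" and "(\<lambda>y. norm (g y)) summable_on B"
    and f: "(f has_sum a) A" and g: "(g has_sum b) B"
  shows "((\<lambda>(x, y). f x * g y) has_sum (a * b)) (A \<times> B)"
proof (rule has_sum_SigmaI)
  show "((\<lambda>y. case (x, y) of (x, y) \<Rightarrow> f x * g y) has_sum (f x * b)) B" for x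
    using has_sum_cmult_right[OF g] by simp
  show "((\<lambda>x. f x * b) has_sum (a * b)) A"
    using f by (rule has_sum_cmult_left)
  show "(\<lambda>(x, y). f x * g y) summable_on A \<times> B"
    using summable_on_norm_times[OF assms(1,2)]
    unfolding case_prod_unfold by (rule abs_summable_summable)
qed

text \<open>One absolutely summable family over (r, n, l) is summed in two orders: tuples first
  gives the theta series, r first gives the required summand.\<close>

lemma double_tuple_sum:
  assumes q: "norm q < 1" and k: "k > 0"
  shows "((\<lambda>(n, l). tuple_weight q k n * tuple_weight q k l *
            (1 / (qfac q (n 1 + l 1) * qfac q (n 1) * qfac q (l 1)))) has_sum
          (\<Sum>r. jacobi_coeff (q ^ (2 * k + 1)) (q ^ (2 * k + 2)) r) / (qpoch_inf q q)\<^sup>2)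
         (nondecreasing_tuples k \<times> nondecreasing_tuples k)"
proof -
  define T where "T = nondecreasing_tuples k"
  define w where "w r n = tuple_weight q k n * bailey_kernel q (n 1) r" for r n
  define a where "a = jacobi_coeff q (q\<^sup>2)"
  define f where "f = (\<lambda>(r, n, l). a r * (w r n * w r l))"
  obtain D where D: "D > 0" "\<And>n r. norm (bailey_kernel q n r) \<le> D"
    using bailey_kernel_bounded[OF q] by blast
  have q2: "norm (q\<^sup>2) < 1"
    using q by (simp add: norm_power power_less_one_iff)
  \<comment> \<open>The bound \<open>D\<close> is uniform in \<open>r\<close>, so one majorant of
    the tuple factors serves all \<open>r\<close>, and the triple family is dominated by a product
    of three summable families.\<close>
  have W: "(\<lambda>n. norm (tuple_weight q k n * of_real D)) summable_on T"
    unfolding norm_mult T_def by (intro summable_on_cmult_left tuple_weight_abs_summable q)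
  have w_le: "norm (w r n) \<le> norm (tuple_weight q k n * of_real D)" for r n
    unfolding w_def norm_mult using D by (intro mult_left_mono) auto
  have w_sm: "(\<lambda>n. norm (w r n)) summable_on T" for r
    using W w_le by (rule Infinite_Sum.abs_summable_on_comparison_test')
  have "summable (\<lambda>r. norm (a r))"
    unfolding a_def by (rule summable_norm_jacobi_coeff[OF q q2])
  hence a_sm: "(\<lambda>r. norm (a r)) summable_on UNIV"
    by (subst summable_on_UNIV_nonneg_real_iff) auto
  have "(\<lambda>(r, p). norm (a r * (case p of (n, l) \<Rightarrow> tuple_weight q k n * of_real D * (tuple_weight q k l * of_real D))))
      summable_on UNIV \<times> (T \<times> T)"
    by (rule summable_on_norm_times[OF a_sm]) (use summable_on_norm_times[OF W W] in \<open>simp add: case_prod_unfold\<close>)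
  hence "(\<lambda>z. norm (f z)) summable_on UNIV \<times> (T \<times> T)"
  proof (rule Infinite_Sum.abs_summable_on_comparison_test')
    fix z :: "nat \<times> (nat \<Rightarrow> nat) \<times> (nat \<Rightarrow> nat)"
    obtain r n l where z: "z = (r, n, l)"
      by (cases z)
    have "norm (w r n) * norm (w r l) \<le> norm (tuple_weight q k n * of_real D) * norm (tuple_weight q k l * of_real D)"
      by (intro mult_mono w_le) auto
    thus "norm (f z) \<le> (case z of (r, p) \<Rightarrow> norm (a r * (case p of (n, l) \<Rightarrow>
        tuple_weight q k n * of_real D * (tuple_weight q k l * of_real D))))"
      unfolding z f_def prod.case norm_mult[of "a r"] norm_mult[of "w r n"]
        norm_mult[of "tuple_weight q k n * of_real D" for n] by (intro mult_left_mono) auto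
  qed
  hence "f summable_on UNIV \<times> (T \<times> T)"
    by (rule abs_summable_summable)
  then obtain S where S: "(f has_sum S) (UNIV \<times> (T \<times> T))"
    by (auto simp: summable_on_def)

  have "((\<lambda>r. a r * ((q ^ (k * r\<^sup>2) / qpoch_inf q q) * (q ^ (k * r\<^sup>2) / qpoch_inf q q))) has_sum S) UNIV"
  proof (rule has_sum_SigmaD[OF S])
    fix r
    have "((\<lambda>(n, l). w r n * w r l) has_sum
        ((q ^ (k * r\<^sup>2) / qpoch_inf q q) * (q ^ (k * r\<^sup>2) / qpoch_inf q q))) (T \<times> T)"
      using w_sm w_sm tuple_sum[OF q k, of r] tuple_sum[OF q k, of r]
      unfolding w_def T_def by (rule has_sum_times)
    from has_sum_cmult_right[OF this, of "a r"]
    show "((\<lambda>p. f (r, p)) has_sum a r * ((q ^ (k * r\<^sup>2) / qpoch_inf q q) * (q ^ (k * r\<^sup>2) / qpoch_inf q q))) (T \<times> T)"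
      by (simp add: f_def case_prod_unfold)
  qed
  moreover have "a r * ((q ^ (k * r\<^sup>2) / qpoch_inf q q) * (q ^ (k * r\<^sup>2) / qpoch_inf q q)) =
      jacobi_coeff (q ^ (2 * k + 1)) (q ^ (2 * k + 2)) r * (1 / (qpoch_inf q q)\<^sup>2)" for r
  proof -
    have "q ^ (k * r\<^sup>2) * q ^ (k * r\<^sup>2) = q ^ (2 * k * r\<^sup>2)"
      by (simp add: mult_2 distrib_right flip: power_add)
    hence "a r * ((q ^ (k * r\<^sup>2) / qpoch_inf q q) * (q ^ (k * r\<^sup>2) / qpoch_inf q q)) =
        jacobi_coeff q (q\<^sup>2) r * q ^ (2 * k * r\<^sup>2) / (qpoch_inf q q)\<^sup>2"
      by (simp add: a_def power2_eq_square)
    thus ?thesis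
      by (simp only: jacobi_coeff_shift times_divide_eq_right mult_1_right)
  qed
  ultimately have "((\<lambda>r. jacobi_coeff (q ^ (2 * k + 1)) (q ^ (2 * k + 2)) r * (1 / (qpoch_inf q q)\<^sup>2)) has_sum S) UNIV"
    by simp
  hence "(\<Sum>r. jacobi_coeff (q ^ (2 * k + 1)) (q ^ (2 * k + 2)) r * (1 / (qpoch_inf q q)\<^sup>2)) = S"
    by (rule sums_unique [symmetric, OF has_sum_imp_sums])
  moreover have sm: "summable (jacobi_coeff (q ^ (2 * k + 1)) (q ^ (2 * k + 2)))"
    by (rule summable_norm_cancel[OF summable_norm_jacobi_coeff])
       (use q in \<open>simp_all add: norm_power power_less_one_iff del: power_Suc\<close>)
  ultimately have S_eq: "S = (\<Sum>r. jacobi_coeff (q ^ (2 * k + 1)) (q ^ (2 * k + 2)) r) / (qpoch_inf q q)\<^sup>2"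
    using suminf_mult2[OF sm, of "1 / (qpoch_inf q q)\<^sup>2"] by simp

  \<comment> \<open>In this order the sum over \<open>r\<close> is finite, because the kernel at
    \<open>l 1\<close> vanishes for \<open>r > l 1\<close>, and \<open>q_dixon_limit\<close>
    evaluates it.\<close>
  have "((\<lambda>(p, r). f (r, p)) has_sum S) ((T \<times> T) \<times> UNIV)"
    using S by (subst (asm) has_sum_swap)
  hence "((\<lambda>(n, l). tuple_weight q k n * tuple_weight q k l *
            (1 / (qfac q (n 1 + l 1) * qfac q (n 1) * qfac q (l 1)))) has_sum S) (T \<times> T)"
  proof (rule has_sum_SigmaD)
    fix p assume "p \<in> T \<times> T"
    obtain n l where p: "p = (n, l)"
      by (cases p)
    have "((\<lambda>r. a r * bailey_kernel q (n 1) r * bailey_kernel q (l 1) r) has_sum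
        (1 / (qfac q (n 1 + l 1) * qfac q (n 1) * qfac q (l 1)))) UNIV"
      unfolding a_def q_dixon_limit[OF q, symmetric]
      by (rule has_sum_finite_neutralI[where B = "{..l 1}"]) (auto simp: bailey_kernel_def)
    from has_sum_cmult_right[OF this, of "tuple_weight q k n * tuple_weight q k l"]
    show "((\<lambda>r. case (p, r) of (p, r) \<Rightarrow> f (r, p)) has_sum
        (case p of (n, l) \<Rightarrow> tuple_weight q k n * tuple_weight q k l *
            (1 / (qfac q (n 1 + l 1) * qfac q (n 1) * qfac q (l 1))))) UNIV"
      by (simp add: p f_def w_def mult_ac)
  qed
  thus ?thesis
    unfolding S_eq T_def .
qed

theorem mainTheorem15:
  fixes k :: nat and q :: complex
  assumes "k \<ge> 1" and "norm q < 1"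
  shows "((\<lambda>(n, l).
            q ^ ((\<Sum>i=1..k. (n i)\<^sup>2) + (\<Sum>i=1..k. (l i)\<^sup>2)) /
              ((\<Prod>i=2..k. qpoch q q (n i - n (i - 1))) * (\<Prod>i=2..k. qpoch q q (l i - l (i - 1)))) *
            (1 / (qpoch q q (n 1 + l 1) * qpoch q q (n 1) * qpoch q q (l 1))))
          has_sum
          (1 / qpoch_inf q q *
            (\<Prod>m. if m \<ge> 1 \<and>
                     \<not> [int m = 0] (mod (4 * int k + 3)) \<and>
                     \<not> [int m = 2 * int k + 1] (mod (4 * int k + 3)) \<and>
                     \<not> [int m = - (2 * int k + 1)] (mod (4 * int k + 3))
                  then 1 / (1 - q ^ m) else 1)))
         (nondecreasing_tuples k \<times> nondecreasing_tuples k)"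
proof -
  have "q ^ ((\<Sum>i=1..k. (n i)\<^sup>2) + (\<Sum>i=1..k. (l i)\<^sup>2)) /
      ((\<Prod>i=2..k. qpoch q q (n i - n (i - 1))) * (\<Prod>i=2..k. qpoch q q (l i - l (i - 1)))) =
      tuple_weight q k n * tuple_weight q k l" for n l
    by (simp add: tuple_weight_def power_add)
  \<comment> \<open>The factor (q;q)_oo obtained here cancels one of the two in the denominator of
    \<open>double_tuple_sum\<close>; the other is the prefactor of the right side.\<close>
  moreover have "(\<Sum>r. jacobi_coeff (q ^ (2 * k + 1)) (q ^ (2 * k + 2)) r) =
      qpoch_inf q q * (\<Prod>m. if m \<ge> 1 \<and>
                     \<not> [int m = 0] (mod (4 * int k + 3)) \<and>
                     \<not> [int m = 2 * int k + 1] (mod (4 * int k + 3)) \<and>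
                     \<not> [int m = - (2 * int k + 1)] (mod (4 * int k + 3))
                  then 1 / (1 - q ^ m) else 1)"
  proof -
    have "q ^ (2 * k + 1) * q ^ (2 * k + 2) = q ^ (4 * k + 3)"
      unfolding power_add [symmetric] by (rule arg_cong) simp
    moreover have "norm (q ^ (2 * k + 1)) < 1" "norm (q ^ (2 * k + 2)) < 1"
      using assms(2) by (simp_all add: norm_power power_less_one_iff del: power_Suc)
    ultimately show ?thesis
      using jacobi_triple_product[of "q ^ (2 * k + 1)" "q ^ (2 * k + 2)"]
        qpoch_inf_times_restricted_product[OF assms(2), of k] by simp
  qed
  ultimately show ?thesis
    using double_tuple_sum[OF assms(2), of k] assms(1) qpoch_inf_nonzero[OF assms(2)]
    by (simp add: power2_eq_square)
qed

end
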